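(* For nonnegative integers $n,m$ let $$N_{n,m}(x)=\sum_{k=0}^n \left(\binom{n}{k}\binom{m}{k}-\binom{n}{k+1}\binom{m}{k-1}\right) x^k .$$ Then for any integers $m\geq 0$ and $n\geq 1$ we have the polynomial identity $$c_{n,m}(x)N_{n,m+1}(x)=a_{n,m}(x) N_{n,m}(x)+b_{n,m}(x) N_{n-1,m}(x),$$ where $$a_{n,m}(x)=(m+2-n)(m^2-n^2+4m+3)x-2n,$$ $$b_{n,m}(x)=n\big[(m+2-n)(m+1-n)x-2\big](x-1),$$ $$c_{n,m}(x)=(m+3)(m+2-n)(m+1-n)x.$$
   Context: Binomial coefficients $\binom{a}{b}$ are taken to be $0$ when $b<0$ or $b>a$. The polynomials $N_{n,m}(x)$ are called generalized Narayana polynomials. *)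

theory Defs
  imports "HOL-Computational_Algebra.Polynomial"
begin

(* The library's choose takes natural numbers only, where k - 1 would truncate at k = 0;
   hence integer arguments. *)
definition binom :: "int \<Rightarrow> int \<Rightarrow> int" where
  "binom a b = (if b < 0 \<or> b > a then 0 else int (nat a choose nat b))"

definition narayana_poly :: "nat \<Rightarrow> nat \<Rightarrow> int poly" where
  "narayana_poly n m =
     (\<Sum>k=0..n. monom (binom (int n) (int k) * binom (int m) (int k)
                    - binom (int n) (int k + 1) * binom (int m) (int k - 1)) k)"

definition a_poly :: "int \<Rightarrow> int \<Rightarrow> int poly" where
  "a_poly n m = [:- (2 * n), (m + 2 - n) * (m\<^sup>2 - n\<^sup>2 + 4 * m + 3):]"

definition b_poly :: "int \<Rightarrow> int \<Rightarrow> int poly" where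
  "b_poly n m = smult n ([:- 2, (m + 2 - n) * (m + 1 - n):] * [:- 1, 1:])"

definition c_poly :: "int \<Rightarrow> int \<Rightarrow> int poly" where
  "c_poly n m = [:0, (m + 3) * (m + 2 - n) * (m + 1 - n):]"

end

theory Submission
  imports Defs
begin

text \<open>
  The coefficient of a fixed power of \<open>x\<close> on either side only involves binomials
  \<open>binom m (k - i)\<close> and \<open>binom (n - 1) (k + 1 - i)\<close> with \<open>0 \<le> i \<le> 3\<close> (after Pascal's rule).
  Each of these is a polynomial multiple of \<open>binom (m + 3) k\<close>, respectively
  \<open>binom (n + 2) (k + 1)\<close>, so both sides become a common factor times a polynomial in
  \<open>n\<close>, \<open>m\<close>, \<open>k\<close>, and the two polynomials agree. Raising the upper index, instead of dividing
  by factors of \<open>k\<close>, makes the argument uniform in \<open>k\<close>, including the boundary cases.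
\<close>

lemma binom_neg: "b < 0 \<Longrightarrow> binom a b = 0"
  by (simp add: binom_def)

lemma binom_of_nat: "binom (int a) (int b) = int (a choose b)"
  by (simp add: binom_def)

lemma binom_Suc: "binom (int a + 1) b = binom (int a) b + binom (int a) (b - 1)"
proof (cases "b \<le> 0")
  case True
  then show ?thesis
    by (cases "b = 0") (simp_all add: binom_def)
next
  case False
  define i where "i = nat (b - 1)"
  have b: "b = int (Suc i)"
    using False by (simp add: i_def)
  have "binom (int (Suc a)) (int (Suc i)) = binom (int a) (int (Suc i)) + binom (int a) (int i)"
    unfolding binom_of_nat by simp
  then show ?thesis
    by (simp add: b add.commute)
qed

lemma binom_absorb: "b * binom (int a + 1) b = (int a + 1) * binom (int a) (b - 1)"
proof (cases "b \<le> 0")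
  case True
  then show ?thesis
    by (cases "b = 0") (simp_all add: binom_neg)
next
  case False
  define i where "i = nat (b - 1)"
  have b: "b = int (Suc i)"
    using False by (simp add: i_def)
  have "int (Suc i) * binom (int (Suc a)) (int (Suc i)) = int (Suc a) * binom (int a) (int i)"
    unfolding binom_of_nat using Suc_times_binomial[of i a]
    by (metis of_nat_mult)
  then show ?thesis
    by (simp add: b add.commute)
qed

text \<open>Pascal's rule times \<open>a + 1\<close>, minus absorption.\<close>

lemma binom_absorb_comp: "(int a + 1 - b) * binom (int a + 1) b = (int a + 1) * binom (int a) b"
  using binom_absorb[of b a] binom_Suc[of a b] by (simp add: algebra_simps)

text \<open>Three absorptions lift the upper index from \<open>a\<close> to \<open>a + 3\<close>.
  They divide only by \<open>a + 1\<close>, \<open>a + 2\<close> and \<open>a + 3\<close>, never by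
  a factor containing \<open>b\<close>, so no value of \<open>b\<close> is exceptional.\<close>

lemma binom_raise_upper3:
  fixes a :: nat and b :: int
  defines "U \<equiv> real_of_int (binom (int (a + 3)) b)
                 / ((real a + 1) * (real a + 2) * (real a + 3))"
  defines "A \<equiv> real a" and "B \<equiv> real_of_int b"
  shows "real_of_int (binom (int a) b) = (A + 3 - B) * (A + 2 - B) * (A + 1 - B) * U"
    and "real_of_int (binom (int a) (b - 1)) = B * (A + 3 - B) * (A + 2 - B) * U"
    and "real_of_int (binom (int a) (b - 2)) = B * (B - 1) * (A + 3 - B) * U"
    and "real_of_int (binom (int a) (b - 3)) = B * (B - 1) * (B - 2) * U"
proof -
  \<comment> \<open>Going from \<open>(a, b - i)\<close> to \<open>(a + 3, b)\<close> takes
    \<open>i\<close> moves that also raise the lower index (\<open>lower\<close>) and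
    \<open>3 - i\<close> that keep it (\<open>same\<close>).\<close>
  have same: "real_of_int (binom (int x) y) =
      (real x + 1 - of_int y) * of_int (binom (int (Suc x)) y) / (real x + 1)" for x y
    using arg_cong[OF binom_absorb_comp[of x y], of real_of_int]
    by (simp add: field_simps)
  have lower: "real_of_int (binom (int x) (y - 1)) =
      of_int y * of_int (binom (int (Suc x)) y) / (real x + 1)" for x y
    using arg_cong[OF binom_absorb[of y x], of real_of_int]
    by (simp add: field_simps)
  have lower2: "real_of_int (binom (int x) (y - 2)) =
      (of_int y - 1) * of_int (binom (int (Suc x)) (y - 1)) / (real x + 1)" for x y
    using lower[of x "y - 1"] by simp
  have lower3: "real_of_int (binom (int x) (y - 3)) =
      (of_int y - 2) * of_int (binom (int (Suc x)) (y - 2)) / (real x + 1)" for x y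
    using lower[of x "y - 2"] by simp
  have S: "a + 3 = Suc (Suc (Suc a))" by simp
  note defs = U_def A_def B_def S
  show "real_of_int (binom (int a) b) = (A + 3 - B) * (A + 2 - B) * (A + 1 - B) * U"
    unfolding defs same[of a] same[of "Suc a"] same[of "Suc (Suc a)"]
    by (simp add: add_ac divide_simps)
  show "real_of_int (binom (int a) (b - 1)) = B * (A + 3 - B) * (A + 2 - B) * U"
    unfolding defs lower[of a] same[of "Suc a"] same[of "Suc (Suc a)"]
    by (simp add: add_ac divide_simps)
  show "real_of_int (binom (int a) (b - 2)) = B * (B - 1) * (A + 3 - B) * U"
    unfolding defs lower2[of a] lower[of "Suc a"] same[of "Suc (Suc a)"]
    by (simp add: add_ac divide_simps)
  show "real_of_int (binom (int a) (b - 3)) = B * (B - 1) * (B - 2) * U"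
    unfolding defs lower3[of a] lower2[of "Suc a"] lower[of "Suc (Suc a)"]
    by (simp add: add_ac divide_simps)
qed

text \<open>The index is an integer so that shifts coming from multiplication by x need no
  truncation.\<close>

definition narayana_coeff :: "nat \<Rightarrow> nat \<Rightarrow> int \<Rightarrow> int" where
  "narayana_coeff n m k =
     binom (int n) k * binom (int m) k - binom (int n) (k + 1) * binom (int m) (k - 1)"

lemma narayana_coeff_neg: "k < 0 \<Longrightarrow> narayana_coeff n m k = 0"
  by (simp add: narayana_coeff_def binom_neg)

lemma coeff_narayana_poly: "coeff (narayana_poly n m) k = narayana_coeff n m (int k)"
proof -
  have "coeff (narayana_poly n m) k =
      (\<Sum>j=0..n. if j = k then narayana_coeff n m (int j) else 0)"
    by (simp add: narayana_poly_def coeff_sum coeff_monom narayana_coeff_def)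
  \<comment> \<open>For \<open>k > n\<close> the sum is empty of matches, and both
    \<open>binom n k\<close> and \<open>binom n (k + 1)\<close> vanish.\<close>
  also have "\<dots> = narayana_coeff n m (int k)"
    by (simp add: narayana_coeff_def binom_def)
  finally show ?thesis .
qed

text \<open>This compares coefficients of x^k in the polynomial identity; the last bracket comes
  from (P x - 2)(x - 1) = P x^2 - (P + 2) x + 2.\<close>

lemma narayana_coeff_recurrence:
  fixes N m :: nat and k :: int
  defines "n \<equiv> int N + 1"
  defines "P \<equiv> (int m + 2 - n) * (int m + 1 - n)"
  shows "(int m + 3) * P * narayana_coeff (Suc N) (Suc m) (k - 1) =
    - (2 * n) * narayana_coeff (Suc N) m k
    + (int m + 2 - n) * ((int m)\<^sup>2 - n\<^sup>2 + 4 * int m + 3) * narayana_coeff (Suc N) m (k - 1)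
    + n * (2 * narayana_coeff N m k - (P + 2) * narayana_coeff N m (k - 1)
           + P * narayana_coeff N m (k - 2))" (is "?l = ?r")
proof -
  define U where "U = real_of_int (binom (int (m + 3)) k)
                        / ((real m + 1) * (real m + 2) * (real m + 3))"
  define V where "V = real_of_int (binom (int (N + 3)) (k + 1))
                        / ((real N + 1) * (real N + 2) * (real N + 3))"
  have shift: "k - 1 + 1 = k" "k - 2 + 1 = k - 1" "k - 1 - 1 = k - 2" "k - 2 - 1 = k - 3"
      "k + 1 - 1 = k" "k + 1 - 2 = k - 1" "k + 1 - 3 = k - 2"
    by simp_all
  \<comment> \<open>After Pascal's rule the lower indices run from \<open>k\<close> to
    \<open>k - 3\<close> over \<open>m\<close> and from \<open>k + 1\<close> to \<open>k - 2\<close>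
    over \<open>N\<close>, hence the base points \<open>k\<close> and \<open>k + 1\<close>.\<close>
  note U = binom_raise_upper3[of m k, folded U_def]
  note V = binom_raise_upper3[of N "k + 1", folded V_def, unfolded shift]
  have Suc: "int (Suc x) = int x + 1" for x by simp
  \<comment> \<open>Every product of two binomials becomes \<open>U * V\<close> times a polynomial,
    leaving a ring identity.\<close>
  have "real_of_int ?l = real_of_int ?r"
    unfolding narayana_coeff_def n_def P_def Suc binom_Suc shift
      of_int_add of_int_mult of_int_diff of_int_minus of_int_power U V
    by (simp add: algebra_simps power2_eq_square)
  then show ?thesis
    by (simp only: of_int_eq_iff)
qed

theorem theorem2p1:
  fixes n m :: nat
  assumes "n \<ge> 1"
  shows "c_poly (int n) (int m) * narayana_poly n (m + 1) =
         a_poly (int n) (int m) * narayana_poly n m +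
         b_poly (int n) (int m) * narayana_poly (n - 1) m"
proof -
  obtain N where N: "n = Suc N"
    using assms by (cases n) auto
  have coeff_shift: "coeff (pCons 0 p) k = (if k = 0 then 0 else coeff p (k - 1))"
    for p :: "int poly" and k
    by (cases k) simp_all
  show ?thesis
  proof (rule poly_eqI)
    fix k
    show "coeff (c_poly (int n) (int m) * narayana_poly n (m + 1)) k =
         coeff (a_poly (int n) (int m) * narayana_poly n m +
         b_poly (int n) (int m) * narayana_poly (n - 1) m) k"
      \<comment> \<open>At \<open>k = 0\<close> and \<open>k = 1\<close> the natural-number shifts
        truncate; the matching terms of the recurrence have negative index and vanish.\<close>
      using narayana_coeff_recurrence[of m N "int k"]
      by (cases "k = 0"; cases "k = 1")
        (simp_all add: c_poly_def a_poly_def b_poly_def N coeff_shift coeff_narayana_poly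
          narayana_coeff_neg of_nat_diff algebra_simps)
  qed
qed

end
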